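(* Let $\mathcal{A}\in\mathbb{C}^{I(N)\times I(N)}$ be a core tensor. Then the following are equivalent: (i) $\mathcal{A}$ is EP; (ii) $(\mathcal{A}^{\mathrm{core}})^{\mathrm{core}}=\mathcal{A}$; (iii) $\mathcal{A}^{\mathrm{core}}*_N\mathcal{A}=\mathcal{A}*_N\mathcal{A}^{\mathrm{core}}$; (iv) $(\mathcal{A}^{\dagger})^{\mathrm{core}}=\mathcal{A}$; (v) $(\mathcal{A}^{\mathrm{core}})^{\dagger}=\mathcal{A}$.
   Context: Let $I_1,\dots,I_N$ be positive integers. $\mathbb{C}^{I(N)\times I(N)}$ denotes the set of complex tensors of order $2N$ with entries $\mathcal{A}_{i_1\dots i_N j_1\dots j_N}$, where $1\le i_k,j_k\le I_k$. The Einstein product is $(\mathcal{A}*_N\mathcal{B})_{i_1\dots i_N j_1\dots j_N}=\sum_{k_1,\dots,k_N}\mathcal{A}_{i_1\dots i_N k_1\dots k_N}\mathcal{B}_{k_1\dots k_N j_1\dots j_N}$, and powers $\mathcal{A}^p$ are taken with respect to $*_N$. The conjugate transpose $\mathcal{A}^*$ is defined by $(\mathcal{A}^* )_{j_1\dots j_N i_1\dots i_N}=\overline{\mathcal{A}_{i_1\dots i_N j_1\dots j_N}}$. The reshaping $\mathrm{rsh}(\mathcal{A})$ is the square matrix of size $I_1\cdots I_N$ obtained by listing the row multi-indices $(i_1,\dots,i_N)$ and the column multi-indices $(j_1,\dots,j_N)$ in the column-major order of Matlab's reshape; $\mathrm{rshrank}(\mathcal{A})$ is the rank of $\mathrm{rsh}(\mathcal{A})$.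 $\mathcal{A}$ is a core tensor if $\mathrm{rshrank}(\mathcal{A})=\mathrm{rshrank}(\mathcal{A}^2)$. The Moore-Penrose inverse $\mathcal{A}^{\dagger}$ is the unique $\mathcal{X}$ with $\mathcal{A}*_N\mathcal{X}*_N\mathcal{A}=\mathcal{A}$, $\mathcal{X}*_N\mathcal{A}*_N\mathcal{X}=\mathcal{X}$, $(\mathcal{A}*_N\mathcal{X})^*=\mathcal{A}*_N\mathcal{X}$, $(\mathcal{X}*_N\mathcal{A})^*=\mathcal{X}*_N\mathcal{A}$. The core inverse $\mathcal{B}^{\mathrm{core}}$ of a core tensor $\mathcal{B}$ is the unique $\mathcal{X}$ with $\mathcal{X}*_N\mathcal{B}^2=\mathcal{B}$, $\mathcal{B}*_N\mathcal{X}^2=\mathcal{X}$, $(\mathcal{B}*_N\mathcal{X})^*=\mathcal{B}*_N\mathcal{X}$. $\mathcal{A}$ is EP if $\mathcal{A}*_N\mathcal{A}^{\dagger}=\mathcal{A}^{\dagger}*_N\mathcal{A}$. *)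

theory Defs
  imports Complex_Main "Jordan_Normal_Form.DL_Rank"
begin

text \<open>A list \<open>I = [I\<^sub>1, \<dots>, I\<^sub>N]\<close> gives the dimensions, so \<open>N = length I\<close>. A multi-index is the list
  of its (1-based) components. A tensor of order \<open>2N\<close> is a function of a row and a column
  multi-index that vanishes outside the index range, so that equality of tensors is equality of
  functions.\<close>

type_synonym tensor = "nat list \<Rightarrow> nat list \<Rightarrow> complex"

definition multi_indices :: "nat list \<Rightarrow> nat list set" where
  "multi_indices I = {i. length i = length I \<and> (\<forall>k<length I. 1 \<le> i ! k \<and> i ! k \<le> I ! k)}"

definition tensors :: "nat list \<Rightarrow> tensor set" where
  "tensors I = {A. \<forall>i j. i \<notin> multi_indices I \<or> j \<notin> multi_indices I \<longrightarrow> A i j = 0}"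

definition einstein_product :: "tensor \<Rightarrow> nat list \<Rightarrow> tensor \<Rightarrow> tensor"
  ("(_ \<star>\<^bsub>_\<^esub> _)" [70, 0, 71] 70) where
  "A \<star>\<^bsub>I\<^esub> B = (\<lambda>i j. \<Sum>k\<in>multi_indices I. A i k * B k j)"

definition unit_tensor :: "nat list \<Rightarrow> tensor" where
  "unit_tensor I = (\<lambda>i j. if i = j \<and> i \<in> multi_indices I then 1 else 0)"

primrec tensor_power :: "nat list \<Rightarrow> tensor \<Rightarrow> nat \<Rightarrow> tensor" where
  "tensor_power I A 0 = unit_tensor I"
| "tensor_power I A (Suc p) = tensor_power I A p \<star>\<^bsub>I\<^esub> A"

definition conj_transpose :: "tensor \<Rightarrow> tensor" where
  "conj_transpose A = (\<lambda>j i. cnj (A i j))"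

text \<open>The multi-index at the (0-based) position \<open>r\<close> of the column-major enumeration, in which the
  first component varies fastest.\<close>

primrec multi_index_at :: "nat list \<Rightarrow> nat \<Rightarrow> nat list" where
  "multi_index_at [] r = []"
| "multi_index_at (d # I) r = (r mod d + 1) # multi_index_at I (r div d)"

definition rsh :: "nat list \<Rightarrow> tensor \<Rightarrow> complex mat" where
  "rsh I A = mat (prod_list I) (prod_list I)
     (\<lambda>(r, c). A (multi_index_at I r) (multi_index_at I c))"

definition rshrank :: "nat list \<Rightarrow> tensor \<Rightarrow> nat" where
  "rshrank I A = vec_space.rank (prod_list I) (rsh I A)"

definition core_tensor :: "nat list \<Rightarrow> tensor \<Rightarrow> bool" where
  "core_tensor I A \<longleftrightarrow> rshrank I A = rshrank I (tensor_power I A 2)"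

definition is_mp_inverse :: "nat list \<Rightarrow> tensor \<Rightarrow> tensor \<Rightarrow> bool" where
  "is_mp_inverse I A X \<longleftrightarrow> X \<in> tensors I \<and>
     A \<star>\<^bsub>I\<^esub> X \<star>\<^bsub>I\<^esub> A = A \<and>
     X \<star>\<^bsub>I\<^esub> A \<star>\<^bsub>I\<^esub> X = X \<and>
     conj_transpose (A \<star>\<^bsub>I\<^esub> X) = A \<star>\<^bsub>I\<^esub> X \<and>
     conj_transpose (X \<star>\<^bsub>I\<^esub> A) = X \<star>\<^bsub>I\<^esub> A"

definition mp_inverse :: "nat list \<Rightarrow> tensor \<Rightarrow> tensor" where
  "mp_inverse I A = (THE X. is_mp_inverse I A X)"

definition is_core_inverse :: "nat list \<Rightarrow> tensor \<Rightarrow> tensor \<Rightarrow> bool" where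
  "is_core_inverse I B X \<longleftrightarrow> X \<in> tensors I \<and>
     X \<star>\<^bsub>I\<^esub> tensor_power I B 2 = B \<and>
     B \<star>\<^bsub>I\<^esub> tensor_power I X 2 = X \<and>
     conj_transpose (B \<star>\<^bsub>I\<^esub> X) = B \<star>\<^bsub>I\<^esub> X"

text \<open>Meaningful only for core tensors \<open>B\<close>.\<close>

definition core_inverse :: "nat list \<Rightarrow> tensor \<Rightarrow> tensor" where
  "core_inverse I B = (THE X. is_core_inverse I B X)"

definition EP_tensor :: "nat list \<Rightarrow> tensor \<Rightarrow> bool" where
  "EP_tensor I A \<longleftrightarrow> A \<star>\<^bsub>I\<^esub> mp_inverse I A = mp_inverse I A \<star>\<^bsub>I\<^esub> A"

text \<open>Matlab's formula for the position of a multi-index: \<open>rsh\<close> puts the entry of \<open>A\<close> at \<open>i\<close>, \<open>j\<close>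
  into the row and column with these (0-based) positions.\<close>

definition position_of :: "nat list \<Rightarrow> nat list \<Rightarrow> nat" where
  "position_of I i = (\<Sum>k<length I. (i ! k - 1) * prod_list (take k I))"

lemma multi_indices_Nil: "multi_indices [] = {[]}"
  by (auto simp: multi_indices_def)

lemma multi_indices_Cons:
  "multi_indices (d # I) = {a # i | a i. 1 \<le> a \<and> a \<le> d \<and> i \<in> multi_indices I}"
proof (intro Set.set_eqI iffI)
  fix x assume x: "x \<in> multi_indices (d # I)"
  then obtain a i where xe: "x = a # i" by (cases x) (auto simp: multi_indices_def)
  from x[unfolded xe] have len: "length i = length I"
    and all: "\<And>k. k < Suc (length I) \<Longrightarrow> 1 \<le> (a # i) ! k \<and> (a # i) ! k \<le> (d # I) ! k"
    by (auto simp: multi_indices_def)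
  from all[of 0] have "1 \<le> a \<and> a \<le> d" by simp
  moreover have "i \<in> multi_indices I" using len all[of "Suc _"] by (auto simp: multi_indices_def)
  ultimately show "x \<in> {a # i | a i. 1 \<le> a \<and> a \<le> d \<and> i \<in> multi_indices I}" using xe by blast
next
  fix x assume "x \<in> {a # i | a i. 1 \<le> a \<and> a \<le> d \<and> i \<in> multi_indices I}"
  then show "x \<in> multi_indices (d # I)" by (auto simp: multi_indices_def nth_Cons split: nat.split)
qed

lemma position_of_Cons: "position_of (d # I) (a # i) = (a - 1) + d * position_of I i"
  by (simp add: position_of_def sum.lessThan_Suc_shift sum_distrib_left mult.left_commute
      del: sum.lessThan_Suc)

lemma position_of_multi_index:
  assumes "i \<in> multi_indices I"
  shows "position_of I i < prod_list I \<and> multi_index_at I (position_of I i) = i"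
  using assms
proof (induction I arbitrary: i)
  case Nil
  then show ?case by (simp add: multi_indices_Nil position_of_def)
next
  case (Cons d I)
  then obtain a i' where i: "i = a # i'" "1 \<le> a" "a \<le> d" "i' \<in> multi_indices I"
    by (auto simp: multi_indices_Cons)
  let ?p = "position_of I i'"
  have IH: "?p < prod_list I" "multi_index_at I ?p = i'" using Cons.IH[OF i(4)] by auto
  have "(a - 1) + d * ?p < d + d * ?p" using i by simp
  also have "\<dots> = d * Suc ?p" by simp
  also have "\<dots> \<le> d * prod_list I" using IH(1) by (intro mult_le_mono2) simp
  finally have "(a - 1) + d * ?p < d * prod_list I" .
  moreover obtain b where "a = Suc b" using i(2) by (cases a) auto
  ultimately show ?case using i IH by (simp add: position_of_Cons)
qed

lemma rsh_entry:
  assumes "i \<in> multi_indices I" "j \<in> multi_indices I"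
  shows "rsh I A $$ (position_of I i, position_of I j) = A i j"
  using position_of_multi_index[OF assms(1)] position_of_multi_index[OF assms(2)]
  by (simp add: rsh_def)

end

theory Submission
  imports Defs
begin

text \<open>If \<open>x\<close> is the core inverse of \<open>a\<close>, then \<open>a a x\<close> is both the core inverse and the Moore-Penrose
  inverse of \<open>x\<close>; it equals \<open>a\<close> exactly when \<open>x\<close> commutes with \<open>a\<close>. When \<open>a\<close> commutes with its
  core inverse or with its Moore-Penrose inverse \<open>m\<close>, these two inverses coincide. Finally, if \<open>a\<close>
  is the core inverse of \<open>m\<close>, then the orthogonal projections \<open>a m\<close> and \<open>m a\<close> absorb each other.
  All this holds in any semigroup with involution, as long as the inverses exist. Existence is
  where linear algebra enters: the rank condition gives factorisations \<open>a = a a x = y a a\<close>, from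
  which the group inverse and then the core inverses of \<open>a\<close> and \<open>m\<close> are built.\<close>

section \<open>Semigroups with involution\<close>

locale involutive_semigroup = semigroup f
  for f :: "'a \<Rightarrow> 'a \<Rightarrow> 'a" (infixl "\<^bold>*" 70) +
  fixes adj :: "'a \<Rightarrow> 'a"
  assumes adj_mult: "adj (a \<^bold>* b) = adj b \<^bold>* adj a"
    and adj_adj [simp]: "adj (adj a) = a"
begin

definition is_mp :: "'a \<Rightarrow> 'a \<Rightarrow> bool" where
  "is_mp a x \<longleftrightarrow> a \<^bold>* x \<^bold>* a = a \<and> x \<^bold>* a \<^bold>* x = x \<and>
     adj (a \<^bold>* x) = a \<^bold>* x \<and> adj (x \<^bold>* a) = x \<^bold>* a"

definition is_core :: "'a \<Rightarrow> 'a \<Rightarrow> bool" where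
  "is_core a x \<longleftrightarrow> x \<^bold>* (a \<^bold>* a) = a \<and> a \<^bold>* (x \<^bold>* x) = x \<and> adj (a \<^bold>* x) = a \<^bold>* x"

text \<open>Applying \<open>adj\<close> to \<open>p q = q\<close> reverses the product and gives
  \<open>q p = q\<close>, to be compared with \<open>q p = p\<close>.\<close>

lemma projections_eqI:
  assumes "adj p = p" "adj q = q" "p \<^bold>* q = q" "q \<^bold>* p = p"
  shows "p = q"
  by (metis assms adj_mult)

lemma projections_mult_commute:
  assumes "adj p = p" "adj q = q" "q \<^bold>* p = q"
  shows "p \<^bold>* q = q"
  using arg_cong[OF assms(3), of adj] assms(1,2) by (simp add: adj_mult)

lemma is_mp_sym: "is_mp a x \<Longrightarrow> is_mp x a"
  by (simp add: is_mp_def)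

text \<open>\<open>a x\<close> and \<open>a y\<close> are orthogonal projections with the same
  range, \<open>x a\<close> and \<open>y a\<close> ones with the same kernel, so they agree in
  pairs; then \<open>x = x a x = x a y = y a y = y\<close>.\<close>

lemma is_mp_unique:
  assumes x: "is_mp a x" and y: "is_mp a y"
  shows "x = y"
proof -
  have "a \<^bold>* x = a \<^bold>* y"
    by (rule projections_eqI) (use x y in \<open>simp_all add: is_mp_def flip: assoc\<close>)
  moreover have "x \<^bold>* a = y \<^bold>* a"
  proof (rule projections_eqI[OF _ _ projections_mult_commute projections_mult_commute])
    show "y \<^bold>* a \<^bold>* (x \<^bold>* a) = y \<^bold>* a" "x \<^bold>* a \<^bold>* (y \<^bold>* a) = x \<^bold>* a"
      using x y by (simp_all add: is_mp_def assoc)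
  qed (use x y in \<open>simp_all add: is_mp_def\<close>)
  ultimately have "x \<^bold>* a \<^bold>* x = y \<^bold>* a \<^bold>* y" by (simp add: assoc)
  thus ?thesis using x y by (simp add: is_mp_def)
qed

text \<open>Expanding the last \<open>a\<close> as \<open>x a a\<close>, or the last
  \<open>x\<close> as \<open>a x x\<close>, makes the other defining equation applicable.\<close>

lemma is_coreD:
  assumes "is_core a x"
  shows "a \<^bold>* x \<^bold>* a = a" "x \<^bold>* a \<^bold>* x = x"
proof -
  have *: "x \<^bold>* (a \<^bold>* a) = a" "a \<^bold>* (x \<^bold>* x) = x" using assms by (simp_all add: is_core_def)
  have "a \<^bold>* x \<^bold>* a = a \<^bold>* (x \<^bold>* x) \<^bold>* (a \<^bold>* a)" by (subst *(1)[symmetric]) (simp add: assoc)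
  thus "a \<^bold>* x \<^bold>* a = a" by (simp add: *)
  have "x \<^bold>* a \<^bold>* x = x \<^bold>* (a \<^bold>* a) \<^bold>* (x \<^bold>* x)" by (subst *(2)[symmetric]) (simp add: assoc)
  thus "x \<^bold>* a \<^bold>* x = x" by (simp add: *)
qed

text \<open>\<open>a x = a y\<close> as both project orthogonally onto the range of
  \<open>a\<close>. Then \<open>y = a y y\<close> gives
  \<open>x = x a y = (x a a) y y = a y y = y\<close>.\<close>

lemma is_core_unique:
  assumes x: "is_core a x" and y: "is_core a y"
  shows "x = y"
proof -
  have "a \<^bold>* x = a \<^bold>* y"
    by (rule projections_eqI)
      (use x y is_coreD[OF x] is_coreD[OF y] in \<open>simp_all add: is_core_def flip: assoc\<close>)
  hence "x = x \<^bold>* (a \<^bold>* y)" using is_coreD(2)[OF x] by (simp add: assoc)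
  also have "\<dots> = x \<^bold>* (a \<^bold>* a) \<^bold>* (y \<^bold>* y)" using y by (metis assoc is_core_def)
  also have "\<dots> = y" using x y by (simp add: is_core_def)
  finally show ?thesis .
qed

text \<open>Urquhart's formula: an inner inverse \<open>s\<close> with \<open>a s\<close>
  self-adjoint and an inner inverse \<open>t\<close> with \<open>t a\<close> self-adjoint combine to
  the Moore-Penrose inverse.\<close>

lemma is_mpI:
  assumes "a \<^bold>* s \<^bold>* a = a" "adj (a \<^bold>* s) = a \<^bold>* s" "a \<^bold>* t \<^bold>* a = a" "adj (t \<^bold>* a) = t \<^bold>* a"
  shows "is_mp a (t \<^bold>* a \<^bold>* s)"
proof -
  have "a \<^bold>* (t \<^bold>* a \<^bold>* s) = a \<^bold>* s" using assms(3) by (simp flip: assoc)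
  moreover have "t \<^bold>* a \<^bold>* s \<^bold>* a = t \<^bold>* a" using assms(1) by (simp add: assoc)
  ultimately show ?thesis using assms unfolding is_mp_def by (simp add: assoc)
qed

text \<open>The product \<open>y a x\<close> is the group inverse of \<open>a\<close>, and multiplying it by the orthogonal
  projection \<open>a m\<close> onto the range of \<open>a\<close> turns it into the core inverse.\<close>

lemma is_coreI:
  assumes x: "a \<^bold>* a \<^bold>* x = a" and y: "y \<^bold>* a \<^bold>* a = a" and m: "is_mp a m"
  shows "is_core a (y \<^bold>* a \<^bold>* x \<^bold>* (a \<^bold>* m))"
proof -
  define g where "g = y \<^bold>* a \<^bold>* x"
  \<comment> \<open>Both sides equal \<open>y a a x\<close>.\<close>
  have e: "y \<^bold>* a = a \<^bold>* x" using x y by (metis assoc)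
  have ag: "a \<^bold>* g = a \<^bold>* x" unfolding g_def e using x by (simp flip: assoc)
  have ga: "g \<^bold>* a = a \<^bold>* x" unfolding g_def e[symmetric] assoc e[symmetric]
    using e y by (metis assoc)
  have ama: "a \<^bold>* m \<^bold>* a = a" using m by (simp add: is_mp_def)
  have axa: "a \<^bold>* x \<^bold>* a = a" using e y by simp
  have 1: "a \<^bold>* (g \<^bold>* (a \<^bold>* m)) = a \<^bold>* m" by (metis ag axa assoc)
  have 2: "g \<^bold>* (a \<^bold>* m) \<^bold>* (a \<^bold>* a) = a"
    by (metis ama assoc e g_def ga y)
  have "a \<^bold>* m \<^bold>* g = g"
    by (metis ama assoc e g_def)
  hence 3: "a \<^bold>* m \<^bold>* (g \<^bold>* (a \<^bold>* m)) = g \<^bold>* (a \<^bold>* m)" by (simp flip: assoc)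
  show ?thesis unfolding is_core_def g_def[symmetric]
    using 1 2 3 m by (simp add: is_mp_def flip: assoc)
qed

text \<open>Here \<open>h\<close> is the group inverse of \<open>adj a\<close>, so \<open>adj a \<^bold>* h\<close> is an idempotent with the same range and
  kernel as \<open>adj a\<close>, hence as \<open>m\<close>.\<close>

lemma mp_inverse_square_factor:
  assumes x: "a \<^bold>* a \<^bold>* x = a" and y: "y \<^bold>* a \<^bold>* a = a" and m: "is_mp a m"
  defines "h \<equiv> adj (y \<^bold>* a \<^bold>* x)"
  shows "m \<^bold>* m \<^bold>* (a \<^bold>* adj a \<^bold>* h) = m" "h \<^bold>* adj a \<^bold>* a \<^bold>* m \<^bold>* m = m"
proof -
  have e: "y \<^bold>* a = a \<^bold>* x" using x y by (metis assoc)
  have "a \<^bold>* (y \<^bold>* a \<^bold>* x) = a \<^bold>* x" unfolding e using x by (simp flip: assoc)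
  hence "a \<^bold>* (y \<^bold>* a \<^bold>* x) \<^bold>* a = a" using e y by simp
  hence aha: "adj a \<^bold>* h \<^bold>* adj a = adj a" unfolding h_def by (metis adj_mult assoc)
  have "y \<^bold>* a \<^bold>* x \<^bold>* a = a \<^bold>* x" using e y by (metis assoc)
  hence comm: "adj a \<^bold>* h = h \<^bold>* adj a" unfolding h_def
    by (metis \<open>a \<^bold>* (y \<^bold>* a \<^bold>* x) = a \<^bold>* x\<close> adj_mult)
  have q: "m \<^bold>* a \<^bold>* adj a = adj a" and p: "adj a \<^bold>* a \<^bold>* m = adj a"
    using m unfolding is_mp_def by (metis adj_mult assoc)+
  \<comment> \<open>In \<open>m = m a m\<close> the self-adjoint factor \<open>m a\<close>,
    respectively \<open>a m\<close>, is replaced by its adjoint; so \<open>m\<close> factors through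
    \<open>adj a\<close> on either side.\<close>
  have mq: "m = adj a \<^bold>* adj m \<^bold>* m" and mp_eq: "m = m \<^bold>* adj m \<^bold>* adj a"
    using m unfolding is_mp_def by (metis adj_mult assoc)+
  have "m \<^bold>* m \<^bold>* (a \<^bold>* adj a \<^bold>* h) = m \<^bold>* (m \<^bold>* a \<^bold>* adj a) \<^bold>* h" by (simp add: assoc)
  also have "\<dots> = m \<^bold>* (h \<^bold>* adj a)" unfolding q comm[symmetric] by (simp add: assoc)
  also have "\<dots> = m" using mp_eq aha comm by (metis assoc)
  finally show "m \<^bold>* m \<^bold>* (a \<^bold>* adj a \<^bold>* h) = m" .
  have "h \<^bold>* adj a \<^bold>* a \<^bold>* m \<^bold>* m = h \<^bold>* (adj a \<^bold>* a \<^bold>* m) \<^bold>* m" by (simp add: assoc)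
  also have "\<dots> = m" unfolding p using mq aha comm by (metis assoc)
  finally show "h \<^bold>* adj a \<^bold>* a \<^bold>* m \<^bold>* m = m" .
qed

section \<open>The equivalences in the abstract setting\<close>

text \<open>Since \<open>x (a a x) = a x\<close>, the self-adjointness required of the new pair is
  the one already known.\<close>

lemma core_of_core:
  assumes "is_core a x"
  shows "is_core x (a \<^bold>* a \<^bold>* x)"
proof -
  have xaa: "x \<^bold>* a \<^bold>* a = a" and axx: "a \<^bold>* x \<^bold>* x = x" and h: "adj (a \<^bold>* x) = a \<^bold>* x"
    using assms by (simp_all add: is_core_def assoc)
  have xy: "x \<^bold>* (a \<^bold>* a \<^bold>* x) = a \<^bold>* x" using xaa by (simp flip: assoc)
  have "a \<^bold>* a \<^bold>* x \<^bold>* (x \<^bold>* x) = x" using axx by (metis assoc)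
  moreover have "x \<^bold>* (a \<^bold>* a \<^bold>* x \<^bold>* (a \<^bold>* a \<^bold>* x)) = a \<^bold>* a \<^bold>* x"
    using xy is_coreD(1)[OF assms] by (metis assoc)
  ultimately show ?thesis unfolding is_core_def xy using h by simp
qed

text \<open>Both products of \<open>x\<close> and \<open>a a x\<close> equal the self-adjoint
  \<open>a x\<close>. Thus a core inverse is always EP, which is why its core and Moore-Penrose
  inverses agree.\<close>

lemma mp_of_core:
  assumes "is_core a x"
  shows "is_mp x (a \<^bold>* a \<^bold>* x)"
proof -
  have xaa: "x \<^bold>* a \<^bold>* a = a" and axx: "a \<^bold>* x \<^bold>* x = x" and h: "adj (a \<^bold>* x) = a \<^bold>* x"
    using assms by (simp_all add: is_core_def assoc)
  have xy: "x \<^bold>* (a \<^bold>* a \<^bold>* x) = a \<^bold>* x" using xaa by (simp flip: assoc)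
  have yx: "a \<^bold>* a \<^bold>* x \<^bold>* x = a \<^bold>* x" using axx by (metis assoc)
  have "a \<^bold>* x \<^bold>* (a \<^bold>* a \<^bold>* x) = a \<^bold>* a \<^bold>* x" using is_coreD(1)[OF assms] by (metis assoc)
  thus ?thesis unfolding is_mp_def xy yx using axx h by simp
qed

text \<open>Commutation turns an inverse of one kind into one of the other kind, and uniqueness
  identifies the two.\<close>

lemma EP_iff_core_commutes:
  assumes x: "is_core a x" and m: "is_mp a m"
  shows "a \<^bold>* m = m \<^bold>* a \<longleftrightarrow> x \<^bold>* a = a \<^bold>* x"
proof
  assume c: "a \<^bold>* m = m \<^bold>* a"
  have "is_core a m" using m c unfolding is_core_def is_mp_def by (metis assoc)
  thus "x \<^bold>* a = a \<^bold>* x" using is_core_unique[OF x] c by simp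
next
  assume c: "x \<^bold>* a = a \<^bold>* x"
  have "is_mp a x" using x c is_coreD[OF x] unfolding is_core_def is_mp_def by simp
  thus "a \<^bold>* m = m \<^bold>* a" using is_mp_unique[OF m] c by simp
qed

text \<open>The right side says that the inverse of \<open>x\<close> found above is \<open>a\<close>
  itself, so conditions (ii), (iii) and (v) are settled together.\<close>

lemma core_commutes_iff:
  assumes "is_core a x"
  shows "x \<^bold>* a = a \<^bold>* x \<longleftrightarrow> a \<^bold>* a \<^bold>* x = a"
proof
  assume "x \<^bold>* a = a \<^bold>* x"
  thus "a \<^bold>* a \<^bold>* x = a" using is_coreD(1)[OF assms] by (simp add: assoc)
next
  assume "a \<^bold>* a \<^bold>* x = a"
  hence "x \<^bold>* a = x \<^bold>* (a \<^bold>* a) \<^bold>* x" by (simp add: assoc)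
  thus "x \<^bold>* a = a \<^bold>* x" using assms by (simp add: is_core_def)
qed

lemma EP_iff_core_of_mp:
  assumes "is_mp a m"
  shows "a \<^bold>* m = m \<^bold>* a \<longleftrightarrow> is_core m a"
proof
  assume "a \<^bold>* m = m \<^bold>* a"
  thus "is_core m a" using assms unfolding is_core_def is_mp_def by (metis assoc)
next
  assume c: "is_core m a"
  \<comment> \<open>\<open>is_core m a\<close> contains \<open>a m m = m\<close> and
    \<open>m a a = a\<close>; these are multiplied on the right by \<open>a\<close> and
    \<open>m\<close>.\<close>
  have "a \<^bold>* m \<^bold>* (m \<^bold>* a) = m \<^bold>* a" "m \<^bold>* a \<^bold>* (a \<^bold>* m) = a \<^bold>* m"
    using c unfolding is_core_def by (metis assoc)+
  thus "a \<^bold>* m = m \<^bold>* a" using projections_eqI assms unfolding is_mp_def by metis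
qed

end

section \<open>Rank and inner inverses of matrices\<close>

text \<open>For the row echelon form \<open>C = P * A\<close>, an inner inverse \<open>H\<close> can
  be read off the pivots; then \<open>H * P\<close> serves for \<open>A\<close>.\<close>

lemma mat_inner_inverse:
  fixes A :: "'a :: field mat"
  assumes A: "A \<in> carrier_mat n m"
  obtains G where "G \<in> carrier_mat m n" "A * G * A = A"
proof -
  define C where "C = gauss_jordan_single A"
  from gauss_jordan_single[OF A C_def[symmetric]] obtain P Q where
    C: "C \<in> carrier_mat n m" "row_echelon_form C" "C = P * A"
    and PQ: "P \<in> carrier_mat n n" "Q \<in> carrier_mat n n" "Q * P = 1\<^sub>m n" by blast
  then obtain f where "pivot_fun C f m" by (auto simp: row_echelon_form_def)
  note f = pivot_funD[OF _ this, of n]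
  \<comment> \<open>For a zero row \<open>i\<close> of \<open>C\<close> the pivot function has the
    value \<open>m\<close>, so column \<open>i\<close> of \<open>H\<close> is zero.\<close>
  define H where "H = mat m n (\<lambda>(j, i). if j = f i then 1 else (0 :: 'a))"
  have H: "H \<in> carrier_mat m n" by (simp add: H_def)
  \<comment> \<open>\<open>H\<close> selects the pivot columns of \<open>C\<close>, which are unit
    vectors; \<open>C * H\<close> is the diagonal projection onto the nonzero rows.\<close>
  have CH: "(C * H) $$ (i, k) = (if i = k \<and> f k < m then 1 else 0)" if "i < n" "k < n" for i k
  proof -
    have "(C * H) $$ (i, k) = (\<Sum>j<m. C $$ (i, j) * (if j = f k then 1 else 0))"
      using that C(1) by (simp add: H_def scalar_prod_def atLeast0LessThan)
    also have "\<dots> = (if f k < m then C $$ (i, f k) else 0)"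
      by (simp add: if_distrib sum.delta cong: if_cong)
    finally show ?thesis using f that C(1) by auto
  qed
  have CHC: "C * H * C = C"
  proof (rule eq_matI)
    fix i j assume ij: "i < dim_row C" "j < dim_col C"
    have "(C * H * C) $$ (i, j) = (\<Sum>k<n. (C * H) $$ (i, k) * C $$ (k, j))"
      using ij C(1) H
      by (subst index_mult_mat(1)) (auto simp: scalar_prod_def atLeast0LessThan)
    also have "\<dots> = (\<Sum>k<n. (if i = k \<and> f k < m then 1 else 0) * C $$ (k, j))"
      using ij C(1) by (intro sum.cong refl) (simp add: CH del: index_mult_mat(1))
    also have "\<dots> = (\<Sum>k<n. if k = i then if f i < m then C $$ (i, j) else 0 else 0)"
      by (intro sum.cong) auto
    also have "\<dots> = (if f i < m then C $$ (i, j) else 0)" using ij C(1) by simp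
    also have "\<dots> = C $$ (i, j)" using f(1)[of i] f(2)[of i j] ij C(1) by auto
    finally show "(C * H * C) $$ (i, j) = C $$ (i, j)" .
  qed (use C(1) H in auto)
  have QC: "Q * C = A"
    unfolding C(3) assoc_mult_mat[OF PQ(2,1) A, symmetric] PQ(3) using A by simp
  have "A * (H * P) * A = A * H * C"
    unfolding C(3) using A H PQ(1) by (simp add: assoc_mult_mat[of _ n _ _ n _ m] assoc_mult_mat[of _ n m _ n _ n])
  also have "\<dots> = Q * C * H * C" unfolding QC ..
  also have "\<dots> = Q * (C * H * C)"
    using PQ(2) C(1) H by (simp add: assoc_mult_mat[of Q n n _ m _ n] assoc_mult_mat[of Q n n _ n _ m])
  also have "\<dots> = A" unfolding CHC QC ..
  finally show thesis by (rule that[OF mult_carrier_mat[OF H PQ(1)]])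
qed

text \<open>The column space of \<open>A * B\<close> lies in that of \<open>A\<close> and has the
  same dimension, so they coincide. Hence each column of \<open>A\<close> is \<open>A * B\<close>
  times some vector, and these vectors are the columns of \<open>X\<close>.\<close>

lemma (in vec_space) rank_mult_eqE:
  assumes A: "A \<in> carrier_mat n m" and B: "B \<in> carrier_mat m k" and rk: "rank (A * B) = rank A"
  obtains X where "X \<in> carrier_mat k m" "A * B * X = A"
proof -
  have AB: "A * B \<in> carrier_mat n k" using A B by simp
  have cA: "set (cols A) \<subseteq> carrier_vec n" and cAB: "set (cols (A * B)) \<subseteq> carrier_vec n"
    using cols_dim A AB by blast+
  obtain U where U: "maximal U (\<lambda>T. T \<subseteq> set (cols (A * B)) \<and> lin_indpt T)"
    using maximal_exists_superset[of "set (cols (A * B))" "\<lambda>T. T \<subseteq> set (cols (A * B)) \<and> lin_indpt T" "{}"]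
    by (metis List.finite_set empty_subsetI finite_lin_indpt2 empty_iff finite.emptyI)
  have Us: "U \<subseteq> set (cols (A * B))" and li: "lin_indpt U" using U by (auto simp: maximal_def)
  have card: "card U = rank A" using rank_card_indpt[OF AB U] rk by simp
  have sub: "span (set (cols (A * B))) \<subseteq> span (set (cols A))"
  proof -
    have "col_space (A * B) \<subseteq> col_space A"
      unfolding col_space_eq[OF A] col_space_eq[OF AB] using A B
      by (auto intro!: exI[of _ "B *\<^sub>v _"])
    thus ?thesis by (simp add: col_space_def)
  qed
  have Uin: "U \<subseteq> span (set (cols A))" using Us sub in_own_span[OF cAB] by blast
  have sm: "submodule class_ring (span (set (cols A))) V" by (rule span_is_submodule[OF cA])
  \<comment> \<open>The span of the columns of \<open>A\<close> is treated as a space of its own: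
    there the independent set \<open>U\<close> has as many elements as the dimension.\<close>
  interpret W: vectorspace class_ring "span_vs (set (cols A))"
    using field.field_axioms vectorspace_def submodule_is_module[OF sm] by metis
  have "W.basis U"
  proof (rule W.dim_li_is_basis)
    show "W.fin_dim" using fin_dim_span_cols[OF A] .
    show "finite U" using Us finite_subset by blast
    show "W.lin_indpt U" using span_li_not_depend(2)[OF Uin sm] li by simp
    show "W.dim \<le> card U" using card by (simp add: rank_def)
  qed (use Uin in simp)
  hence "span (set (cols A)) = span U"
    using span_li_not_depend(1)[OF Uin sm] by (simp add: W.basis_def)
  also have "\<dots> \<subseteq> span (set (cols (A * B)))" by (rule span_is_monotone[OF Us])
  finally have "col_space A \<subseteq> col_space (A * B)" by (simp add: col_space_def)
  moreover have "col A j \<in> col_space A" if "j < m" for j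
    unfolding col_space_def using that A cols_dim in_own_span[OF cA] by (auto simp: cols_def)
  ultimately have "\<exists>x\<in>carrier_vec k. A * B *\<^sub>v x = col A j" if "j < m" for j
    using that A B unfolding col_space_eq[OF AB] by auto
  then obtain x where x: "\<And>j. j < m \<Longrightarrow> x j \<in> carrier_vec k \<and> A * B *\<^sub>v x j = col A j" by metis
  define X where "X = mat k m (\<lambda>(i, j). x j $ i)"
  have X: "X \<in> carrier_mat k m" by (simp add: X_def)
  have "col X j = x j" if "j < m" for j using x[OF that] that by (auto simp: X_def)
  hence "col (A * B * X) j = col A j" if "j < m" for j
    using x[OF that] that col_mult2[OF AB X] by simp
  hence "A * B * X = A" using A X by (intro mat_col_eqI) auto
  with X that show thesis by blast
qed

text \<open>Since \<open>E = A G\<close> is an idempotent with the range of \<open>A\<close>, the matrix \<open>U = A E + (1 - E)\<close> has the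
  right inverse \<open>Y = A X G + (1 - E)\<close>. A one-sided inverse of a square matrix is two-sided, and
  \<open>U A = A A\<close>.\<close>

lemma mat_square_left_inverse:
  fixes A :: "'a :: field mat"
  assumes A: "A \<in> carrier_mat n n" and X: "X \<in> carrier_mat n n" and AX: "A * A * X = A"
  obtains Y where "Y \<in> carrier_mat n n" "Y * A * A = A"
proof -
  obtain G where G: "G \<in> carrier_mat n n" "A * G * A = A" by (rule mat_inner_inverse[OF A])
  define E where "E = A * G"
  define U where "U = A * E + (1\<^sub>m n - E)"
  define Y where "Y = A * X * G + (1\<^sub>m n - E)"
  have E: "E \<in> carrier_mat n n" and XG: "A * X * G \<in> carrier_mat n n" using A X G by (auto simp: E_def)
  have D: "1\<^sub>m n - E \<in> carrier_mat n n" using E by (simp add: minus_carrier_mat)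
  have AE: "A * E \<in> carrier_mat n n" using A E by simp
  have U: "U \<in> carrier_mat n n" and Y: "Y \<in> carrier_mat n n" using AE D XG by (auto simp: U_def Y_def)
  have EA: "E * A = A" using G by (simp add: E_def)
  have EE: "E * E = E" using EA A G E by (metis E_def assoc_mult_mat)
  \<comment> \<open>These identities make the cross terms of \<open>U * Y\<close> vanish.\<close>
  have DA: "(1\<^sub>m n - E) * A = 0\<^sub>m n n" and DE: "(1\<^sub>m n - E) * E = 0\<^sub>m n n" and ED: "E * (1\<^sub>m n - E) = 0\<^sub>m n n"
    using A E EA EE
    by (simp_all add: minus_mult_distrib_mat[of _ n n] mult_minus_distrib_mat[of _ n n _ n])
  have "A * E * (A * X * G) = A * (E * A) * X * G" using A E X G by (simp add: assoc_mult_mat[of _ n n _ n _ n])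
  hence 1: "A * E * (A * X * G) = E" using EA AX by (simp add: E_def)
  have 2: "(1\<^sub>m n - E) * (A * X * G) = 0\<^sub>m n n"
  proof -
    have "(1\<^sub>m n - E) * (A * X * G) = (1\<^sub>m n - E) * A * X * G"
      using A D X G by (simp add: assoc_mult_mat[of _ n n _ n _ n])
    thus ?thesis using DA X G by simp
  qed
  have 3: "A * E * (1\<^sub>m n - E) = 0\<^sub>m n n" using A E D ED by simp
  have 4: "(1\<^sub>m n - E) * (1\<^sub>m n - E) = 1\<^sub>m n - E"
    unfolding mult_minus_distrib_mat[OF D one_carrier_mat E] DE using D E by (intro eq_matI) auto
  have "U * Y = U * (A * X * G) + U * (1\<^sub>m n - E)" using U XG D by (simp add: Y_def mult_add_distrib_mat)
  also have "U * (A * X * G) = E" using AE D XG E 1 2 by (simp add: U_def add_mult_distrib_mat)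
  also have "U * (1\<^sub>m n - E) = 1\<^sub>m n - E" using AE D 3 4 by (simp add: U_def add_mult_distrib_mat)
  also have "E + (1\<^sub>m n - E) = 1\<^sub>m n" using E by (intro eq_matI) auto
  finally have YU: "Y * U = 1\<^sub>m n" by (rule mat_mult_left_right_inverse[OF U Y])
  have UA: "U * A = A * A"
    unfolding U_def add_mult_distrib_mat[OF AE D A] DA assoc_mult_mat[OF A E A] EA using A by simp
  have "Y * A * A = A"
    unfolding assoc_mult_mat[OF Y A A] UA[symmetric] assoc_mult_mat[OF Y U A, symmetric] YU
    using A by simp
  with Y that show thesis by blast
qed

section \<open>Tensors under the Einstein product\<close>

lemma finite_multi_indices: "finite (multi_indices I)"
  by (rule inj_on_finite[of "position_of I" _ "{..<prod_list I}"])
    (use position_of_multi_index in \<open>auto intro: inj_on_inverseI[of _ "multi_index_at I"]\<close>)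

lemma einstein_product_assoc:
  "(A \<star>\<^bsub>I\<^esub> B) \<star>\<^bsub>I\<^esub> C = A \<star>\<^bsub>I\<^esub> (B \<star>\<^bsub>I\<^esub> C)"
  unfolding einstein_product_def sum_distrib_left sum_distrib_right
  by (intro ext, subst sum.swap) (simp add: mult.assoc)

lemma conj_transpose_einstein_product:
  "conj_transpose (A \<star>\<^bsub>I\<^esub> B) = conj_transpose B \<star>\<^bsub>I\<^esub> conj_transpose A"
  by (simp add: einstein_product_def conj_transpose_def mult.commute)

text \<open>The contraction runs over the index range only, so the laws hold for arbitrary
  functions; membership in \<open>tensors I\<close> is tracked separately.\<close>

interpretation einstein: involutive_semigroup "\<lambda>A B. A \<star>\<^bsub>I\<^esub> B" conj_transpose for I
  by unfold_locales
    (simp_all add: einstein_product_assoc conj_transpose_einstein_product, simp add: conj_transpose_def)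

lemma einstein_product_in_tensors [intro]:
  "A \<in> tensors I \<Longrightarrow> B \<in> tensors I \<Longrightarrow> A \<star>\<^bsub>I\<^esub> B \<in> tensors I"
  by (auto simp: tensors_def einstein_product_def)

lemma conj_transpose_in_tensors [intro]: "A \<in> tensors I \<Longrightarrow> conj_transpose A \<in> tensors I"
  by (auto simp: tensors_def conj_transpose_def)

lemma unit_tensor_einstein_product:
  assumes "A \<in> tensors I"
  shows "unit_tensor I \<star>\<^bsub>I\<^esub> A = A"
proof (intro ext)
  fix i j
  have "(unit_tensor I \<star>\<^bsub>I\<^esub> A) i j = (\<Sum>k\<in>multi_indices I. if i = k then A k j else 0)"
    unfolding einstein_product_def unit_tensor_def by (intro sum.cong) auto
  also have "\<dots> = A i j"
    using assms by (auto simp: finite_multi_indices tensors_def)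
  finally show "(unit_tensor I \<star>\<^bsub>I\<^esub> A) i j = A i j" .
qed

lemma tensor_power_2: "A \<in> tensors I \<Longrightarrow> tensor_power I A 2 = A \<star>\<^bsub>I\<^esub> A"
  by (simp add: numeral_2_eq_2 unit_tensor_einstein_product)

text \<open>The squared norm of each column of \<open>A B - A\<close> expands into four diagonal
  entries, which cancel because all four products equal \<open>A* A\<close>.\<close>

lemma conj_transpose_cancel:
  assumes A: "A \<in> tensors I"
    and eq: "conj_transpose A \<star>\<^bsub>I\<^esub> A \<star>\<^bsub>I\<^esub> B = conj_transpose A \<star>\<^bsub>I\<^esub> A"
    and B: "B \<in> tensors I"
  shows "A \<star>\<^bsub>I\<^esub> B = A"
proof (intro ext)
  fix i j
  define M where "M = A \<star>\<^bsub>I\<^esub> B"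
  have AM: "conj_transpose A \<star>\<^bsub>I\<^esub> M = conj_transpose A \<star>\<^bsub>I\<^esub> A"
    using eq by (simp add: M_def einstein_product_assoc)
  have MA: "conj_transpose M \<star>\<^bsub>I\<^esub> A = conj_transpose A \<star>\<^bsub>I\<^esub> A"
    using arg_cong[OF AM, of conj_transpose] by (simp add: conj_transpose_einstein_product)
  have MM: "conj_transpose M \<star>\<^bsub>I\<^esub> M = conj_transpose M \<star>\<^bsub>I\<^esub> A"
    unfolding M_def conj_transpose_einstein_product einstein_product_assoc
    using AM by (simp add: M_def)
  have "complex_of_real (\<Sum>k\<in>multi_indices I. (cmod (M k j - A k j))\<^sup>2) =
      (\<Sum>k\<in>multi_indices I. cnj (M k j) * M k j - cnj (A k j) * M k j
        - (cnj (M k j) * A k j - cnj (A k j) * A k j))"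
    unfolding of_real_sum complex_norm_square by (intro sum.cong refl) (simp add: algebra_simps)
  also have "\<dots> = (conj_transpose M \<star>\<^bsub>I\<^esub> M) j j - (conj_transpose A \<star>\<^bsub>I\<^esub> M) j j
      - ((conj_transpose M \<star>\<^bsub>I\<^esub> A) j j - (conj_transpose A \<star>\<^bsub>I\<^esub> A) j j)"
    by (simp add: einstein_product_def conj_transpose_def sum_subtractf)
  also have "\<dots> = 0" by (simp add: AM MM MA)
  finally have "(\<Sum>k\<in>multi_indices I. (cmod (M k j - A k j))\<^sup>2) = 0" by (simp only: of_real_eq_0_iff)
  hence "\<forall>k\<in>multi_indices I. M k j = A k j"
    by (simp add: sum_nonneg_eq_0_iff finite_multi_indices)
  \<comment> \<open>Outside the index range both sides are zero.\<close>
  moreover have "M \<in> tensors I" using A B by (auto simp: M_def)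
  ultimately show "(A \<star>\<^bsub>I\<^esub> B) i j = A i j" using A unfolding M_def tensors_def by fastforce
qed

section \<open>Reshaping as a multiplicative bijection onto square matrices\<close>

lemma multi_index_at_inverse:
  "r < prod_list I \<Longrightarrow> multi_index_at I r \<in> multi_indices I \<and> position_of I (multi_index_at I r) = r"
proof (induction I arbitrary: r)
  case Nil
  then show ?case by (simp add: multi_indices_Nil position_of_def)
next
  case (Cons d I)
  \<comment> \<open>A zero dimension would make the product zero and leave no
    \<open>r\<close>.\<close>
  have "d > 0" using Cons.prems by (cases d) auto
  moreover have "r div d < prod_list I" using Cons.prems by (simp add: less_mult_imp_div_less mult.commute)
  ultimately show ?case using Cons.IH
    by (auto simp: multi_indices_Cons position_of_Cons Suc_leI)
qed

lemma bij_betw_multi_index_at: "bij_betw (multi_index_at I) {..<prod_list I} (multi_indices I)"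
  by (rule bij_betw_byWitness[where f' = "position_of I"])
    (use position_of_multi_index multi_index_at_inverse in auto)

lemma rsh_carrier [simp]: "rsh I A \<in> carrier_mat (prod_list I) (prod_list I)"
  by (simp add: rsh_def)

lemma rsh_einstein_product: "rsh I (A \<star>\<^bsub>I\<^esub> B) = rsh I A * rsh I B"
proof (rule eq_matI)
  fix r c assume "r < dim_row (rsh I A * rsh I B)" "c < dim_col (rsh I A * rsh I B)"
  thus "rsh I (A \<star>\<^bsub>I\<^esub> B) $$ (r, c) = (rsh I A * rsh I B) $$ (r, c)"
    by (simp add: rsh_def einstein_product_def scalar_prod_def atLeast0LessThan
        sum.reindex_bij_betw[OF bij_betw_multi_index_at, symmetric])
qed (simp_all add: rsh_def)

lemma rsh_inj:
  assumes "A \<in> tensors I" "B \<in> tensors I" "rsh I A = rsh I B"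
  shows "A = B"
proof (intro ext)
  fix i j
  show "A i j = B i j"
  proof (cases "i \<in> multi_indices I \<and> j \<in> multi_indices I")
    case True
    thus ?thesis using rsh_entry[of i I j A] rsh_entry[of i I j B] assms(3) by simp
  qed (use assms in \<open>auto simp: tensors_def\<close>)
qed

lemma rsh_surj:
  assumes "M \<in> carrier_mat (prod_list I) (prod_list I)"
  obtains A where "A \<in> tensors I" "rsh I A = M"
proof
  define A where "A = (\<lambda>i j. if i \<in> multi_indices I \<and> j \<in> multi_indices I
    then M $$ (position_of I i, position_of I j) else 0)"
  show "A \<in> tensors I" by (auto simp: A_def tensors_def)
  show "rsh I A = M"
    using assms by (intro eq_matI) (auto simp: rsh_def A_def multi_index_at_inverse)
qed

lemma tensor_inner_inverse:
  assumes A: "A \<in> tensors I"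
  obtains G where "G \<in> tensors I" "A \<star>\<^bsub>I\<^esub> G \<star>\<^bsub>I\<^esub> A = A"
proof -
  obtain M where "M \<in> carrier_mat (prod_list I) (prod_list I)" "rsh I A * M * rsh I A = rsh I A"
    by (rule mat_inner_inverse[OF rsh_carrier])
  then obtain G where G: "G \<in> tensors I" "rsh I (A \<star>\<^bsub>I\<^esub> G \<star>\<^bsub>I\<^esub> A) = rsh I A"
    by (metis rsh_surj rsh_einstein_product)
  hence "A \<star>\<^bsub>I\<^esub> G \<star>\<^bsub>I\<^esub> A = A" using A by (intro rsh_inj[of _ I]) auto
  with G that show thesis by blast
qed

text \<open>The rank condition yields the right factor \<open>X\<close>; the left factor
  \<open>Y\<close> is then derived from it at the matrix level.\<close>

lemma core_tensorE:
  assumes A: "A \<in> tensors I" and c: "core_tensor I A"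
  obtains X Y where "X \<in> tensors I" "Y \<in> tensors I"
    "A \<star>\<^bsub>I\<^esub> A \<star>\<^bsub>I\<^esub> X = A" "Y \<star>\<^bsub>I\<^esub> A \<star>\<^bsub>I\<^esub> A = A"
proof -
  let ?n = "prod_list I"
  have "vec_space.rank ?n (rsh I A * rsh I A) = vec_space.rank ?n (rsh I A)"
    using c by (simp add: core_tensor_def rshrank_def tensor_power_2[OF A] rsh_einstein_product)
  then obtain M where M: "M \<in> carrier_mat ?n ?n" "rsh I A * rsh I A * M = rsh I A"
    by (rule vec_space.rank_mult_eqE[OF rsh_carrier rsh_carrier])
  then obtain L where L: "L \<in> carrier_mat ?n ?n" "L * rsh I A * rsh I A = rsh I A"
    by (rule mat_square_left_inverse[OF rsh_carrier])
  from M obtain X where X: "X \<in> tensors I" "rsh I (A \<star>\<^bsub>I\<^esub> A \<star>\<^bsub>I\<^esub> X) = rsh I A"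
    by (metis rsh_surj rsh_einstein_product)
  from L obtain Y where Y: "Y \<in> tensors I" "rsh I (Y \<star>\<^bsub>I\<^esub> A \<star>\<^bsub>I\<^esub> A) = rsh I A"
    by (metis rsh_surj rsh_einstein_product)
  have "A \<star>\<^bsub>I\<^esub> A \<star>\<^bsub>I\<^esub> X = A" "Y \<star>\<^bsub>I\<^esub> A \<star>\<^bsub>I\<^esub> A = A"
    using A X Y by (auto intro!: rsh_inj[of _ I])
  with X Y that show thesis by blast
qed

section \<open>Existence and values of the inverses of tensors\<close>

lemma is_mp_inverse_iff: "is_mp_inverse I A X \<longleftrightarrow> X \<in> tensors I \<and> einstein.is_mp I A X"
  by (simp add: is_mp_inverse_def einstein.is_mp_def)

lemma is_core_inverse_iff:
  "A \<in> tensors I \<Longrightarrow> is_core_inverse I A X \<longleftrightarrow> X \<in> tensors I \<and> einstein.is_core I A X"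
  by (auto simp: is_core_inverse_def einstein.is_core_def tensor_power_2)

lemma mp_inverse_eqI:
  assumes "X \<in> tensors I" "einstein.is_mp I A X"
  shows "mp_inverse I A = X"
  unfolding mp_inverse_def is_mp_inverse_iff
  using assms einstein.is_mp_unique by (intro the_equality) auto

lemma core_inverse_eqI:
  assumes "A \<in> tensors I" "X \<in> tensors I" "einstein.is_core I A X"
  shows "core_inverse I A = X"
  unfolding core_inverse_def is_core_inverse_iff[OF assms(1)]
  using assms einstein.is_core_unique by (intro the_equality) auto

text \<open>If \<open>G\<close> is an inner inverse of \<open>A* A\<close>, then cancelling \<open>A*\<close> in \<open>A* A G A* A = A* A\<close>
  shows that \<open>G A*\<close> is an inner inverse of \<open>A\<close>.\<close>

lemma hermitian_inner_inverse:
  assumes A: "A \<in> tensors I"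
  obtains S where "S \<in> tensors I" "A \<star>\<^bsub>I\<^esub> S \<star>\<^bsub>I\<^esub> A = A"
    "conj_transpose (A \<star>\<^bsub>I\<^esub> S) = A \<star>\<^bsub>I\<^esub> S"
proof -
  let ?A' = "conj_transpose A"
  obtain G where G: "G \<in> tensors I"
    "(?A' \<star>\<^bsub>I\<^esub> A) \<star>\<^bsub>I\<^esub> G \<star>\<^bsub>I\<^esub> (?A' \<star>\<^bsub>I\<^esub> A) = ?A' \<star>\<^bsub>I\<^esub> A"
    using tensor_inner_inverse[of "?A' \<star>\<^bsub>I\<^esub> A" I] A by blast
  define S where "S = G \<star>\<^bsub>I\<^esub> ?A'"
  have S: "S \<in> tensors I" using A G by (auto simp: S_def)
  have ASA: "A \<star>\<^bsub>I\<^esub> (S \<star>\<^bsub>I\<^esub> A) = A"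
    by (rule conj_transpose_cancel) (use A S G in \<open>auto simp: S_def einstein_product_assoc\<close>)
  hence h: "conj_transpose A = ?A' \<star>\<^bsub>I\<^esub> (conj_transpose S \<star>\<^bsub>I\<^esub> ?A')"
    by (metis conj_transpose_einstein_product einstein_product_assoc)
  \<comment> \<open>The chain ends in \<open>A S\<close> times its own conjugate transpose, which is
    self-adjoint.\<close>
  have "A \<star>\<^bsub>I\<^esub> S = A \<star>\<^bsub>I\<^esub> G \<star>\<^bsub>I\<^esub> ?A' \<star>\<^bsub>I\<^esub> (conj_transpose S \<star>\<^bsub>I\<^esub> ?A')"
    by (subst S_def, subst h) (simp add: einstein_product_assoc)
  also have "\<dots> = (A \<star>\<^bsub>I\<^esub> S) \<star>\<^bsub>I\<^esub> conj_transpose (A \<star>\<^bsub>I\<^esub> S)"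
    by (simp add: S_def einstein_product_assoc conj_transpose_einstein_product)
  finally have "conj_transpose (A \<star>\<^bsub>I\<^esub> S) = A \<star>\<^bsub>I\<^esub> S"
    by (metis conj_transpose_einstein_product einstein.adj_adj)
  with S ASA that show thesis by (simp add: einstein_product_assoc)
qed

text \<open>The preceding lemma gives \<open>S\<close> from \<open>A\<close>; applied to the
  conjugate transpose of \<open>A\<close> and transposed back, it gives \<open>T\<close>. Urquhart's
  formula joins them.\<close>

lemma mp_inverse_exists:
  assumes A: "A \<in> tensors I"
  obtains X where "X \<in> tensors I" "einstein.is_mp I A X"
proof -
  obtain S where S: "S \<in> tensors I" "A \<star>\<^bsub>I\<^esub> S \<star>\<^bsub>I\<^esub> A = A"
    "conj_transpose (A \<star>\<^bsub>I\<^esub> S) = A \<star>\<^bsub>I\<^esub> S"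
    by (rule hermitian_inner_inverse[OF A])
  obtain R where R: "R \<in> tensors I"
    "conj_transpose A \<star>\<^bsub>I\<^esub> R \<star>\<^bsub>I\<^esub> conj_transpose A = conj_transpose A"
    "conj_transpose (conj_transpose A \<star>\<^bsub>I\<^esub> R) = conj_transpose A \<star>\<^bsub>I\<^esub> R"
    by (rule hermitian_inner_inverse[OF conj_transpose_in_tensors[OF A]])
  define T where "T = conj_transpose R"
  have T: "A \<star>\<^bsub>I\<^esub> T \<star>\<^bsub>I\<^esub> A = A" "conj_transpose (T \<star>\<^bsub>I\<^esub> A) = T \<star>\<^bsub>I\<^esub> A"
    using arg_cong[OF R(2), of conj_transpose] R(3)
    by (simp_all add: T_def conj_transpose_einstein_product einstein_product_assoc)
  have "T \<star>\<^bsub>I\<^esub> A \<star>\<^bsub>I\<^esub> S \<in> tensors I" using A S(1) R(1) unfolding T_def by auto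
  moreover have "einstein.is_mp I A (T \<star>\<^bsub>I\<^esub> A \<star>\<^bsub>I\<^esub> S)"
    by (rule einstein.is_mpI[OF S(2,3) T])
  ultimately show thesis by (rule that)
qed

theorem theorem3p6:
  fixes I :: "nat list" and A :: tensor
  assumes "I \<noteq> []" and "\<forall>d\<in>set I. 0 < d"
    and "A \<in> tensors I" and "core_tensor I A"
  shows "(EP_tensor I A \<longleftrightarrow> core_inverse I (core_inverse I A) = A) \<and>
         (EP_tensor I A \<longleftrightarrow> core_inverse I A \<star>\<^bsub>I\<^esub> A = A \<star>\<^bsub>I\<^esub> core_inverse I A) \<and>
         (EP_tensor I A \<longleftrightarrow> core_inverse I (mp_inverse I A) = A) \<and>
         (EP_tensor I A \<longleftrightarrow> mp_inverse I (core_inverse I A) = A)"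
proof -
  note A = assms(3)
  obtain X Y where XY: "X \<in> tensors I" "Y \<in> tensors I"
    "A \<star>\<^bsub>I\<^esub> A \<star>\<^bsub>I\<^esub> X = A" "Y \<star>\<^bsub>I\<^esub> A \<star>\<^bsub>I\<^esub> A = A"
    by (rule core_tensorE[OF A assms(4)])
  obtain M where M: "M \<in> tensors I" "einstein.is_mp I A M" by (rule mp_inverse_exists[OF A])
  define C where "C = Y \<star>\<^bsub>I\<^esub> A \<star>\<^bsub>I\<^esub> X \<star>\<^bsub>I\<^esub> (A \<star>\<^bsub>I\<^esub> M)"
  have C: "C \<in> tensors I" "einstein.is_core I A C"
    unfolding C_def using A XY(1,2) M einstein.is_coreI[OF XY(3,4) M(2)] by blast+
  define H where "H = conj_transpose (Y \<star>\<^bsub>I\<^esub> A \<star>\<^bsub>I\<^esub> X)"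
  have H: "H \<in> tensors I" using A XY(1,2) by (auto simp: H_def)
  \<comment> \<open>This is the formula of \<open>is_coreI\<close> for \<open>M\<close> in place of
    \<open>a\<close>: the factors come from \<open>mp_inverse_square_factor\<close>, and
    \<open>A\<close> is the Moore-Penrose inverse of \<open>M\<close>.\<close>
  define D where "D = H \<star>\<^bsub>I\<^esub> conj_transpose A \<star>\<^bsub>I\<^esub> A \<star>\<^bsub>I\<^esub> M \<star>\<^bsub>I\<^esub>
    (A \<star>\<^bsub>I\<^esub> conj_transpose A \<star>\<^bsub>I\<^esub> H) \<star>\<^bsub>I\<^esub> (M \<star>\<^bsub>I\<^esub> A)"
  have D: "D \<in> tensors I" "einstein.is_core I M D"
  proof -
    show "D \<in> tensors I"
      unfolding D_def using A H M(1) by (intro einstein_product_in_tensors conj_transpose_in_tensors)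
    show "einstein.is_core I M D"
      unfolding D_def H_def
      by (rule einstein.is_coreI[OF einstein.mp_inverse_square_factor[OF XY(3,4) M(2)]
            einstein.is_mp_sym[OF M(2)]])
  qed
  have K: "A \<star>\<^bsub>I\<^esub> A \<star>\<^bsub>I\<^esub> C \<in> tensors I" using A C(1) by auto
  have eqs: "mp_inverse I A = M" "core_inverse I A = C" "core_inverse I M = D"
      "core_inverse I C = A \<star>\<^bsub>I\<^esub> A \<star>\<^bsub>I\<^esub> C" "mp_inverse I C = A \<star>\<^bsub>I\<^esub> A \<star>\<^bsub>I\<^esub> C"
    using A M C D K einstein.core_of_core[OF C(2)] einstein.mp_of_core[OF C(2)]
    by (auto intro: mp_inverse_eqI core_inverse_eqI)
  have EP: "EP_tensor I A \<longleftrightarrow> C \<star>\<^bsub>I\<^esub> A = A \<star>\<^bsub>I\<^esub> C"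
    unfolding EP_tensor_def eqs by (rule einstein.EP_iff_core_commutes[OF C(2) M(2)])
  moreover have "EP_tensor I A \<longleftrightarrow> D = A"
    unfolding EP_tensor_def eqs einstein.EP_iff_core_of_mp[OF M(2)]
    using D(2) einstein.is_core_unique by blast
  \<comment> \<open>By \<open>eqs\<close>, (ii) and (v) both read \<open>A A C = A\<close>, which is
    equivalent to commutation.\<close>
  ultimately show ?thesis
    unfolding eqs using einstein.core_commutes_iff[OF C(2)] by simp
qed

end
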